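(* Let $k\ge 0$ and $n,m\ge k+5$. Then $\mathrm{f}\mu^{k}(K_m\times K_n)=mn-4-k$.
   Context: For an integer $k\ge 0$ and a connected graph $G$, a set $X\subseteq V(G)$ is a $k$-fault-tolerant mutual-visibility set ($k$-ftmv set) if for any two non-adjacent vertices $u,v\in X$ there exist $k+1$ internally vertex-disjoint shortest $u,v$-paths $Q_1,\dots,Q_{k+1}$ in $G$ such that $V(Q_i)\cap X=\{u,v\}$ for every $i$. $\mathrm{f}\mu^{k}(G)$ denotes the maximum cardinality of a $k$-ftmv set of $G$. $K_n$ is the complete graph on $n$ vertices and $G\times H$ is the direct product: vertex set $V(G)\times V(H)$, with $(g,h)\sim(g',h')$ iff $gg'\in E(G)$ and $hh'\in E(H)$. *)

theory Defs
  imports "Graph_Theory.Vertex_Walk" "Graph_Theory.Kuratowski"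
begin

text \<open>
  Simple graphs are represented as \<^locale>\<open>pair_graph\<close>s: finite, loop-free digraphs without
  parallel arcs whose arc relation is symmetric. \<^term>\<open>(u, v) \<in> parcs G\<close> is adjacency.
\<close>

definition direct_product ::
    "'a pair_pre_digraph \<Rightarrow> 'b pair_pre_digraph \<Rightarrow> ('a \<times> 'b) pair_pre_digraph" where
  "direct_product G H =
     \<lparr> pverts = pverts G \<times> pverts H,
       parcs = {((g, h), (g', h')) | g h g' h'. (g, g') \<in> parcs G \<and> (h, h') \<in> parcs H} \<rparr>"

definition path_betw :: "'a pair_pre_digraph \<Rightarrow> 'a \<Rightarrow> 'a \<Rightarrow> 'a vwalk \<Rightarrow> bool" where
  "path_betw G u v p \<longleftrightarrow> vpath p (with_proj G) \<and> hd p = u \<and> last p = v"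

definition shortest_path_betw :: "'a pair_pre_digraph \<Rightarrow> 'a \<Rightarrow> 'a \<Rightarrow> 'a vwalk \<Rightarrow> bool" where
  "shortest_path_betw G u v p \<longleftrightarrow>
     path_betw G u v p \<and> (\<forall>q. path_betw G u v q \<longrightarrow> vwalk_length p \<le> vwalk_length q)"

text \<open>
  The paths \<open>Q 0, \<dots>, Q k\<close> below are automatically distinct: since \<open>u\<close> and \<open>v\<close> are
  different and non-adjacent, each path has an internal vertex, which it shares with no other.
\<close>

definition ftmv_set :: "nat \<Rightarrow> 'a pair_pre_digraph \<Rightarrow> 'a set \<Rightarrow> bool" where
  "ftmv_set k G X \<longleftrightarrow>
     X \<subseteq> pverts G \<and>
     (\<forall>u\<in>X. \<forall>v\<in>X. u \<noteq> v \<and> (u, v) \<notin> parcs G \<longrightarrow>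
        (\<exists>Q :: nat \<Rightarrow> 'a vwalk.
           (\<forall>i<k+1. shortest_path_betw G u v (Q i) \<and> set (Q i) \<inter> X = {u, v}) \<and>
           (\<forall>i<k+1. \<forall>j<k+1. i \<noteq> j \<longrightarrow> set (Q i) \<inter> set (Q j) = {u, v})))"

text \<open>For finite \<open>G\<close> the maximum ranges over a finite set, nonempty because of \<open>X = {}\<close>.\<close>

definition ftmv_number :: "nat \<Rightarrow> 'a pair_pre_digraph \<Rightarrow> nat" where
  "ftmv_number k G = Max {card X | X. ftmv_set k G X}"

end

theory Submission
  imports Defs
begin

text \<open>
  Two distinct non-adjacent vertices of \<open>K\<^sub>m \<times> K\<^sub>n\<close> lie on a common line (row or column) of the
  \<open>m \<times> n\<close> grid and are at distance 2. So a set with complement \<open>C\<close> is \<open>k\<close>-ftmv iff, for any two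
  of its vertices on a line, at least \<open>k + 1\<close> points of \<open>C\<close> avoid every line through either of them.
  If \<open>C\<close> is a partial transversal with \<open>k + 4\<close> points, the three lines through the two vertices
  meet \<open>C\<close> in at most three points. Conversely, if \<open>C\<close> has \<open>k + 3\<close> points (or fewer, by heredity),
  one finds two vertices outside \<open>C\<close> in a row whose three lines meet \<open>C\<close> in at least three points:
  either two points of \<open>C\<close> share a column, and a row free of \<open>C\<close> works, or the columns of the points
  of \<open>C\<close> are distinct, and a row through a point of \<open>C\<close> works.
\<close>

section \<open>Fault-tolerant mutual visibility in graphs of diameter two\<close>

definition common_nbrs :: "'a pair_pre_digraph \<Rightarrow> 'a \<Rightarrow> 'a \<Rightarrow> 'a set" where
  "common_nbrs G u v = {w \<in> pverts G. (u, w) \<in> parcs G \<and> (w, v) \<in> parcs G}"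

lemma length_path_betw_nonadjacent:
  assumes "path_betw G u v p" "u \<noteq> v" "(u, v) \<notin> parcs G"
  shows "3 \<le> length p"
proof (rule ccontr)
  assume "\<not> 3 \<le> length p"
  then consider "p = []" | x where "p = [x]" | x y where "p = [x, y]"
    by (cases p rule: vwalk_arcs.cases) (auto simp: Suc_le_eq not_less_eq_eq)
  then show False
    by cases (use assms in \<open>auto simp: path_betw_def vpath_def vwalk_def\<close>)
qed

lemma path_betw_length3_iff:
  assumes "u \<in> pverts G" "v \<in> pverts G" "u \<noteq> v" "(u, v) \<notin> parcs G"
  shows "path_betw G u v p \<and> length p = 3 \<longleftrightarrow> (\<exists>w\<in>common_nbrs G u v. p = [u, w, v])"
  using assms
  by (auto simp: path_betw_def vpath_def vwalk_def common_nbrs_def numeral_3_eq_3 length_Suc_conv)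

text \<open>A common neighbour puts the two vertices at distance exactly two, so shortest paths
  correspond to their middle vertices.\<close>

lemma shortest_path_betw_iff_common_nbr:
  assumes "u \<in> pverts G" "v \<in> pverts G" "u \<noteq> v" "(u, v) \<notin> parcs G"
    and "common_nbrs G u v \<noteq> {}"
  shows "shortest_path_betw G u v p \<longleftrightarrow> (\<exists>w\<in>common_nbrs G u v. p = [u, w, v])"
proof -
  obtain q where q: "path_betw G u v q" "length q = 3"
    using assms path_betw_length3_iff[OF assms(1-4)] by blast
  have "shortest_path_betw G u v p \<longleftrightarrow> path_betw G u v p \<and> length p = 3"
  proof
    assume "shortest_path_betw G u v p"
    then have "path_betw G u v p" "length p - 1 \<le> length q - 1"
      using q(1) by (auto simp: shortest_path_betw_def)
    then show "path_betw G u v p \<and> length p = 3"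
      using q(2) length_path_betw_nonadjacent[OF _ assms(3,4), of p] by simp
  next
    assume "path_betw G u v p \<and> length p = 3"
    then show "shortest_path_betw G u v p"
      using length_path_betw_nonadjacent[OF _ assms(3,4)]
      by (fastforce simp: shortest_path_betw_def)
  qed
  then show ?thesis
    using path_betw_length3_iff[OF assms(1-4)] by simp
qed

text \<open>Paths of length two are internally disjoint iff their middle vertices differ, so a
  family of \<open>k + 1\<close> such paths avoiding \<open>X\<close> inside is an injection of the
  indices into \<open>common_nbrs G u v - X\<close>.\<close>

lemma ftmv_set_iff_card_common_nbrs:
  assumes fin: "finite (pverts G)"
    and diam: "\<And>u v. u \<in> pverts G \<Longrightarrow> v \<in> pverts G \<Longrightarrow> u \<noteq> v \<Longrightarrow> (u, v) \<notin> parcs G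
                 \<Longrightarrow> common_nbrs G u v \<noteq> {}"
  shows "ftmv_set k G X \<longleftrightarrow> X \<subseteq> pverts G \<and>
    (\<forall>u\<in>X. \<forall>v\<in>X. u \<noteq> v \<and> (u, v) \<notin> parcs G \<longrightarrow> k + 1 \<le> card (common_nbrs G u v - X))"
proof -
  have paths_iff: "(\<exists>Q. (\<forall>i<k+1. shortest_path_betw G u v (Q i) \<and> set (Q i) \<inter> X = {u, v}) \<and>
           (\<forall>i<k+1. \<forall>j<k+1. i \<noteq> j \<longrightarrow> set (Q i) \<inter> set (Q j) = {u, v}))
        \<longleftrightarrow> k + 1 \<le> card (common_nbrs G u v - X)" (is "(\<exists>Q. ?P Q) \<longleftrightarrow> _")
    if X: "X \<subseteq> pverts G" and uv: "u \<in> X" "v \<in> X" "u \<noteq> v" "(u, v) \<notin> parcs G" for u v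
  proof -
    have finN: "finite (common_nbrs G u v - X)"
      using fin by (simp add: common_nbrs_def)
    have uv_verts: "u \<in> pverts G" "v \<in> pverts G"
      using X uv by auto
    note path_iff = shortest_path_betw_iff_common_nbr[OF uv_verts uv(3,4) diam[OF uv_verts uv(3,4)]]
    show ?thesis
    proof
      assume "\<exists>Q. ?P Q"
      then obtain Q where Q: "?P Q" ..
      then have "\<forall>i<k+1. \<exists>w\<in>common_nbrs G u v. Q i = [u, w, v]"
        using path_iff by blast
      then obtain w where w: "\<And>i. i < k+1 \<Longrightarrow> w i \<in> common_nbrs G u v \<and> Q i = [u, w i, v]"
        by metis
      have inner: "w i \<notin> X \<and> w i \<noteq> u \<and> w i \<noteq> v" if "i < k+1" for i
      proof -
        \<comment> \<open>Equality with an endpoint would turn an arc at \<open>w i\<close> into the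
          excluded arc from \<open>u\<close> to \<open>v\<close>.\<close>
        have "w i \<noteq> u" "w i \<noteq> v"
          using w[OF that] uv by (auto simp: common_nbrs_def)
        moreover have "set (Q i) \<inter> X = {u, v}"
          using Q that by blast
        then have "{u, w i, v} \<inter> X = {u, v}"
          using w[OF that] by simp
        ultimately show ?thesis by blast
      qed
      have "inj_on w {..<k+1}"
      proof (rule inj_onI, rule ccontr)
        fix i j assume ij: "i \<in> {..<k+1}" "j \<in> {..<k+1}" "w i = w j" "i \<noteq> j"
        then have "set (Q i) \<inter> set (Q j) = {u, v}"
          using Q by blast
        then show False
          using ij w[of i] w[of j] inner[of i] by auto
      qed
      moreover have "w ` {..<k+1} \<subseteq> common_nbrs G u v - X"
        using w inner by auto
      ultimately show "k + 1 \<le> card (common_nbrs G u v - X)"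
        using card_inj_on_le[OF _ _ finN] by fastforce
    next
      assume "k + 1 \<le> card (common_nbrs G u v - X)"
      then obtain w where w: "w ` {..<k+1} \<subseteq> common_nbrs G u v - X" "inj_on w {..<k+1}"
        using card_le_inj[of "{..<k+1}", OF _ finN] by auto
      have "?P (\<lambda>i. [u, w i, v])"
        using w uv by (auto simp: path_iff inj_on_def image_subset_iff)
      then show "\<exists>Q. ?P Q" by (rule exI[of ?P])
    qed
  qed
  show ?thesis
    unfolding ftmv_set_def
    by (intro conj_cong ball_cong imp_cong refl; (elim conjE)?; rule paths_iff; assumption)
qed

section \<open>Point sets in a grid\<close>

lemma card_inj_preimage_pair_le:
  assumes "finite C" "inj_on f C"
  shows "card {c \<in> C. f c \<in> {x, y}} \<le> card {x, y}"
  using assms by (intro card_inj_on_le[of f]) (auto intro: inj_on_subset)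

text \<open>A shared coordinate makes two of the four lines through \<open>u\<close> and
  \<open>v\<close> coincide, and by injectivity each line holds at most one point of
  \<open>C\<close>.\<close>

lemma card_transversal_on_lines_le:
  assumes "finite C" "inj_on fst C" "inj_on snd C" "fst u = fst v \<or> snd u = snd v"
  shows "card {c \<in> C. fst c \<in> {fst u, fst v} \<or> snd c \<in> {snd u, snd v}} \<le> 3"
proof -
  have "{c \<in> C. fst c \<in> {fst u, fst v} \<or> snd c \<in> {snd u, snd v}}
      = {c \<in> C. fst c \<in> {fst u, fst v}} \<union> {c \<in> C. snd c \<in> {snd u, snd v}}"
    by blast
  then have "card {c \<in> C. fst c \<in> {fst u, fst v} \<or> snd c \<in> {snd u, snd v}}
      \<le> card {c \<in> C. fst c \<in> {fst u, fst v}} + card {c \<in> C. snd c \<in> {snd u, snd v}}"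
    by (simp only: card_Un_le)
  also have "\<dots> \<le> card {fst u, fst v} + card {snd u, snd v}"
    using assms by (intro add_mono card_inj_preimage_pair_le)
  also have "\<dots> \<le> 3"
    using assms(4) by (auto simp: card_insert_if)
  finally show ?thesis .
qed

lemma exists_transversal:
  assumes "finite A" "finite B" "l \<le> card A" "l \<le> card B"
  obtains C where "C \<subseteq> A \<times> B" "card C = l" "inj_on fst C" "inj_on snd C"
proof -
  obtain a where a: "a ` {..<l} \<subseteq> A" "inj_on a {..<l}"
    using card_le_inj[of "{..<l}" A] assms by auto
  obtain b where b: "b ` {..<l} \<subseteq> B" "inj_on b {..<l}"
    using card_le_inj[of "{..<l}" B] assms by auto
  \<comment> \<open>Pairing two injections index by index gives a diagonal, which both projections
    keep injective.\<close>
  let ?C = "(\<lambda>i. (a i, b i)) ` {..<l}"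
  show thesis
  proof
    show "card ?C = l"
      using a(2) by (subst card_image) (auto simp: inj_on_def)
  qed (use a b in \<open>auto simp: inj_on_def\<close>)
qed

lemma exists_not_in_image:
  assumes "finite C" "card C < card A"
  obtains a where "a \<in> A" "a \<notin> f ` C"
proof -
  have "card (f ` C) < card A"
    using assms card_image_le[of C f] by linarith
  then have "\<not> A \<subseteq> f ` C"
    using assms card_mono[of "f ` C" A] by auto
  then show thesis using that by blast
qed

text \<open>The points of \<open>C\<close> occupy at most \<open>card C\<close> columns, and a
  column without points of \<open>C\<close> is free in every row.\<close>

lemma card_free_in_row_ge:
  assumes "finite B" "finite C" "card C + 2 \<le> card B"
  shows "2 \<le> card {h \<in> B. (g, h) \<notin> C}"
proof -
  have "B - snd ` C \<subseteq> {h \<in> B. (g, h) \<notin> C}"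
    by force
  then have "card (B - snd ` C) \<le> card {h \<in> B. (g, h) \<notin> C}"
    using assms by (intro card_mono) auto
  moreover have "card B - card (snd ` C) \<le> card (B - snd ` C)"
    using assms by (intro diff_card_le_card_Diff) auto
  ultimately show ?thesis
    using assms card_image_le[of C snd] by linarith
qed

lemma exists_pair_in_row_covering_three:
  assumes fin: "finite A" "finite B" "finite C"
    and C: "C \<subseteq> A \<times> B" "3 \<le> card C" "card C + 2 \<le> card A" "card C + 2 \<le> card B"
  obtains g h h' where "g \<in> A" "h \<in> B" "h' \<in> B" "h \<noteq> h'" "(g, h) \<notin> C" "(g, h') \<notin> C"
    "3 \<le> card {c \<in> C. fst c = g \<or> snd c \<in> {h, h'}}"
proof -
  define F where "F g = {h \<in> B. (g, h) \<notin> C}" for g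
  have "\<exists>g\<in>A. \<exists>S T. card S \<le> 2 \<and> S \<subseteq> F g \<and> T \<subseteq> C \<and> card T = 3 \<and>
          (\<forall>t\<in>T. fst t = g \<or> snd t \<in> S)"
  proof (cases "inj_on snd C")
    case False
    then obtain c1 c2 where c12: "c1 \<in> C" "c2 \<in> C" "c1 \<noteq> c2" "snd c1 = snd c2"
      by (auto simp: inj_on_def)
    then have "card {c1, c2} < card C"
      using C(2) by simp
    then have "\<not> C \<subseteq> {c1, c2}"
      using card_mono[of "{c1, c2}" C] by auto
    then obtain c3 where c3: "c3 \<in> C" "c3 \<noteq> c1" "c3 \<noteq> c2"
      by blast
    \<comment> \<open>In a row without points of \<open>C\<close> every column is free; the column
      shared by \<open>c1\<close> and \<open>c2\<close> and the column of \<open>c3\<close> cover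
      three points.\<close>
    obtain g where g: "g \<in> A" "g \<notin> fst ` C"
      using exists_not_in_image[of C A fst] fin C(3) by auto
    have "{snd c1, snd c3} \<subseteq> F g"
      using g c12 c3 C(1) by (force simp: F_def)
    moreover have "card {snd c1, snd c3} \<le> 2"
      by (simp add: card_insert_if)
    moreover have "card {c1, c2, c3} = 3"
      using c12 c3 by auto
    ultimately show ?thesis
      using g c12 c3
      by (intro bexI[of _ g] exI[of _ "{snd c1, snd c3}"] exI[of _ "{c1, c2, c3}"]) auto
  next
    case True
    obtain T where T: "T \<subseteq> C" "card T = 3"
      using obtain_subset_with_card_n[OF C(2)] by blast
    then obtain c1 c2 c3 where T_eq: "T = {c1, c2, c3}"
      by (auto simp: card_3_iff)
    have "card {snd c2, snd c3} \<le> 2"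
      by (simp add: card_insert_if)
    then have "card ({snd c2, snd c3} \<inter> F (fst c1)) \<le> 2"
      using card_mono[of "{snd c2, snd c3}" "{snd c2, snd c3} \<inter> F (fst c1)"] by simp
    \<comment> \<open>If the column of \<open>t\<close> is not free in the row of \<open>c1\<close>,
      then the point of \<open>C\<close> blocking it is \<open>t\<close> itself, which the row
      already covers.\<close>
    moreover have "fst t = fst c1 \<or> snd t \<in> {snd c2, snd c3} \<inter> F (fst c1)" if "t \<in> T" for t
    proof (cases "(fst c1, snd t) \<in> C")
      case True
      then have "t = (fst c1, snd t)"
        using \<open>inj_on snd C\<close> \<open>t \<in> T\<close> T(1) by (auto simp: inj_on_def)
      then show ?thesis by (metis fst_conv)
    next
      case False
      then show ?thesis
        using that T T_eq C(1) by (auto simp: F_def)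
    qed
    moreover have "fst c1 \<in> A"
      using T T_eq C(1) by auto
    ultimately show ?thesis
      using T by (intro bexI[of _ "fst c1"] exI[of _ "{snd c2, snd c3} \<inter> F (fst c1)"] exI[of _ T]) auto
  qed
  then obtain g S T where g: "g \<in> A" and S: "card S \<le> 2" "S \<subseteq> F g"
    and T: "T \<subseteq> C" "card T = 3" "\<forall>t\<in>T. fst t = g \<or> snd t \<in> S"
    by blast
  have "2 \<le> card (F g)"
    using card_free_in_row_ge[of B C g] fin C by (simp add: F_def)
  \<comment> \<open>Padding \<open>S\<close> to exactly two free columns keeps \<open>T\<close>
    covered.\<close>
  then obtain D where D: "S \<subseteq> D" "D \<subseteq> F g" "card D = 2"
    using exists_subset_between[of S 2 "F g"] S fin by (auto simp: F_def)
  then obtain h h' where hh: "D = {h, h'}" "h \<noteq> h'"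
    by (auto simp: card_2_iff)
  have "T \<subseteq> {c \<in> C. fst c = g \<or> snd c \<in> {h, h'}}"
    using T D(1) hh by blast
  then have "3 \<le> card {c \<in> C. fst c = g \<or> snd c \<in> {h, h'}}"
    using card_mono[of "{c \<in> C. fst c = g \<or> snd c \<in> {h, h'}}" T] T(2) fin by simp
  then show thesis
    using that[of g h h'] g D hh by (auto simp: F_def)
qed

section \<open>Direct products of complete graphs\<close>

locale complete_product =
  fixes G :: "'a pair_pre_digraph" and H :: "'b pair_pre_digraph" and k m n :: nat
  assumes n: "k + 5 \<le> n" and m: "k + 5 \<le> m"
    and G: "K\<^bsub>m\<^esub> (with_proj G)" and H: "K\<^bsub>n\<^esub> (with_proj H)"
begin

abbreviation "P \<equiv> direct_product G H"

lemma finite_factors: "finite (pverts G)" "finite (pverts H)"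
  and card_factors: "card (pverts G) = m" "card (pverts H) = n"
  and parcs_factors: "parcs G = {(x, y). x \<in> pverts G \<and> y \<in> pverts G \<and> x \<noteq> y}"
    "parcs H = {(x, y). x \<in> pverts H \<and> y \<in> pverts H \<and> x \<noteq> y}"
  using G H by (auto simp: complete_digraph_pair_def)

lemma pverts_product: "pverts P = pverts G \<times> pverts H"
  by (simp add: direct_product_def)

lemma finite_product: "finite (pverts P)"
  by (simp add: pverts_product finite_factors)

lemma card_product: "card (pverts P) = m * n"
  by (simp add: pverts_product card_cartesian_product card_factors)

lemma adjacent_product_iff:
  "(u, v) \<in> parcs P \<longleftrightarrow>
     u \<in> pverts P \<and> v \<in> pverts P \<and> fst u \<noteq> fst v \<and> snd u \<noteq> snd v"
  by (cases u; cases v) (auto simp: direct_product_def parcs_factors)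

lemma common_nbrs_product:
  assumes "u \<in> pverts P" "v \<in> pverts P"
  shows "common_nbrs P u v =
    {w \<in> pverts P. fst w \<notin> {fst u, fst v} \<and> snd w \<notin> {snd u, snd v}}"
  using assms by (auto simp: common_nbrs_def adjacent_product_iff)

text \<open>Each coordinate excludes at most two values, and each factor has at least five
  vertices.\<close>

lemma common_nbrs_product_nonempty:
  assumes "u \<in> pverts P" "v \<in> pverts P"
  shows "common_nbrs P u v \<noteq> {}"
proof -
  have small: "card {x, y} < 3" for x y :: 'c
    by (simp add: card_insert_if)
  obtain g where "g \<in> pverts G" "g \<notin> {fst u, fst v}"
    using exists_not_in_image[of "{fst u, fst v}" "pverts G" id] small[of "fst u" "fst v"]
      card_factors m by auto
  moreover obtain h where "h \<in> pverts H" "h \<notin> {snd u, snd v}"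
    using exists_not_in_image[of "{snd u, snd v}" "pverts H" id] small[of "snd u" "snd v"]
      card_factors n by auto
  ultimately have "(g, h) \<in> common_nbrs P u v"
    using common_nbrs_product[OF assms] by (simp add: pverts_product)
  then show ?thesis by blast
qed

lemma ftmv_set_product_iff:
  "ftmv_set k P X \<longleftrightarrow> X \<subseteq> pverts P \<and>
    (\<forall>u\<in>X. \<forall>v\<in>X. u \<noteq> v \<and> (u, v) \<notin> parcs P \<longrightarrow> k + 1 \<le> card (common_nbrs P u v - X))"
  using common_nbrs_product_nonempty by (intro ftmv_set_iff_card_common_nbrs finite_product)

text \<open>Shrinking the set only enlarges the supply of common neighbours outside it.\<close>

lemma ftmv_set_subset:
  assumes "ftmv_set k P X" "Y \<subseteq> X"
  shows "ftmv_set k P Y"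
proof -
  have "card (common_nbrs P u v - X) \<le> card (common_nbrs P u v - Y)" for u v
    using assms(2) finite_product by (intro card_mono) (auto simp: common_nbrs_def)
  then show ?thesis
    using assms unfolding ftmv_set_product_iff by (meson order_trans subset_iff)
qed

lemma ex_ftmv_set: "\<exists>X. ftmv_set k P X \<and> card X = m * n - 4 - k"
proof -
  obtain C where C: "C \<subseteq> pverts P" "card C = k + 4" "inj_on fst C" "inj_on snd C"
    using exists_transversal[OF finite_factors, of "k + 4"] m n
    by (auto simp: card_factors pverts_product)
  have finC: "finite C"
    using C finite_product finite_subset by blast
  have "k + 1 \<le> card (common_nbrs P u v - (pverts P - C))"
    if uv: "u \<in> pverts P - C" "v \<in> pverts P - C" "u \<noteq> v" "(u, v) \<notin> parcs P" for u v
  proof -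
    let ?L = "{c \<in> C. fst c \<in> {fst u, fst v} \<or> snd c \<in> {snd u, snd v}}"
    have "fst u = fst v \<or> snd u = snd v"
      using uv by (auto simp: adjacent_product_iff)
    then have "card ?L \<le> 3"
      using card_transversal_on_lines_le[OF finC C(3,4)] by blast
    \<comment> \<open>The usable middle vertices are the points of \<open>C\<close> off the lines
      through \<open>u\<close> and \<open>v\<close>, at least \<open>(k + 4) - 3\<close> of
      them.\<close>
    moreover have "common_nbrs P u v - (pverts P - C) = C - ?L"
      using C(1) uv by (auto simp: common_nbrs_product)
    moreover have "card (C - ?L) = card C - card ?L"
      using finC by (intro card_Diff_subset) auto
    ultimately show ?thesis
      using C(2) by simp
  qed
  then have "ftmv_set k P (pverts P - C)"
    by (auto simp: ftmv_set_product_iff)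
  moreover have "card (pverts P - C) = m * n - 4 - k"
    using C finC by (simp add: card_Diff_subset card_product)
  ultimately show ?thesis by blast
qed

lemma card_ftmv_set_le:
  assumes X: "ftmv_set k P X"
  shows "card X \<le> m * n - 4 - k"
proof (rule ccontr)
  assume "\<not> card X \<le> m * n - 4 - k"
  then have "m * n - (k + 3) \<le> card X" by linarith
  \<comment> \<open>Heredity reduces the claim to complements of exactly \<open>k + 3\<close>
    points.\<close>
  then obtain Y where Y: "Y \<subseteq> X" "card Y = m * n - (k + 3)"
    by (meson obtain_subset_with_card_n)
  have ftmv: "ftmv_set k P Y"
    using ftmv_set_subset X Y by blast
  then have Y_verts: "Y \<subseteq> pverts P"
    by (simp add: ftmv_set_def)
  define C where "C = pverts P - Y"
  \<comment> \<open>This keeps the subtraction in \<open>card Y\<close> from truncating, so that the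
    complement really has \<open>k + 3\<close> points.\<close>
  have "(k + 5) * 1 \<le> m * n"
    using m n by (intro mult_mono) auto
  then have card_C: "card C = k + 3"
    using Y(2) Y_verts finite_product
    by (simp add: C_def card_Diff_subset finite_subset card_product)
  have fin_C: "finite C"
    by (simp add: C_def finite_product)
  \<comment> \<open>For \<open>card C = k + 3\<close>, the room required in each factor,
    \<open>card C + 2\<close>, is exactly \<open>k + 5\<close>.\<close>
  obtain g h h' where gh: "g \<in> pverts G" "h \<in> pverts H" "h' \<in> pverts H" "h \<noteq> h'"
    "(g, h) \<notin> C" "(g, h') \<notin> C" "3 \<le> card {c \<in> C. fst c = g \<or> snd c \<in> {h, h'}}"
    using exists_pair_in_row_covering_three[OF finite_factors fin_C] card_C m n
    by (auto simp: C_def pverts_product card_factors)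
  let ?u = "(g, h)" and ?v = "(g, h')" and ?L = "{c \<in> C. fst c = g \<or> snd c \<in> {h, h'}}"
  have uv: "?u \<in> pverts P" "?v \<in> pverts P" "?u \<in> Y" "?v \<in> Y"
    using gh by (auto simp: C_def pverts_product)
  have "k + 1 \<le> card (common_nbrs P ?u ?v - Y)"
    using ftmv uv gh(4) unfolding ftmv_set_product_iff by (auto simp: adjacent_product_iff)
  \<comment> \<open>With three or more of the \<open>k + 3\<close> points on the lines, at most
    \<open>k\<close> middle vertices remain.\<close>
  also have "common_nbrs P ?u ?v - Y = C - ?L"
    using uv by (auto simp: common_nbrs_product C_def)
  also have "card (C - ?L) = card C - card ?L"
    using fin_C by (intro card_Diff_subset) auto
  finally show False
    using card_C gh(7) by linarith
qed

lemma ftmv_number_product: "ftmv_number k P = m * n - 4 - k"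
  unfolding ftmv_number_def
proof (rule Max_eqI)
  have "{card X | X. ftmv_set k P X} \<subseteq> {..m * n - 4 - k}"
    using card_ftmv_set_le by auto
  then show "finite {card X | X. ftmv_set k P X}"
    using finite_subset by blast
  show "m * n - 4 - k \<in> {card X | X. ftmv_set k P X}"
    using ex_ftmv_set by (metis (mono_tags, lifting) mem_Collect_eq)
qed (use card_ftmv_set_le in auto)

end

theorem theorem7p2:
  fixes G :: "'a pair_pre_digraph" and H :: "'b pair_pre_digraph" and k m n :: nat
  assumes "k + 5 \<le> n" and "k + 5 \<le> m"
    and "K\<^bsub>m\<^esub> (with_proj G)" and "K\<^bsub>n\<^esub> (with_proj H)"
  shows "ftmv_number k (direct_product G H) = m * n - 4 - k"
  using complete_product.ftmv_number_product[OF complete_product.intro] assms by blast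

end
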